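(* Let $n,s\ge 2$ and $k_1,\dots,k_s$ be positive integers, let $q\ge 0$ be a real number, let $\alpha_1,\dots,\alpha_s$ be positive reals, and let $S$ be a set of positive integers. For $i\in[s]$ let $\mathcal F_i\subset\binom{[n]}{k_i}$ be such that for any $F_1\in\mathcal F_1,\dots,F_s\in\mathcal F_s$ there exists $\ell\in S$ with $$\sum_{i=1}^s\alpha_i|F_i\cap[\ell]|\ge \ell+q. \qquad ( * )$$ Fix a positive real $r$. Then there exist families $\mathcal J_1\subset\binom{[n]}{k_1},\dots,\mathcal J_s\subset\binom{[n]}{k_s}$ that are juntas with center $[j]$, such that for any $F_1\in\mathcal J_1,\dots,F_s\in\mathcal J_s$ the inequality $( * )$ holds for some $\ell\in S\cap[j]$, and moreover $$|\mathcal F_i\setminus\mathcal J_i|\le\Big(\frac{k_i}{n}\Big)^r\binom{n}{k_i}\quad\text{for every } i\in[s],$$ provided one of the following three conditions holds for some real $\epsilon\in(0,1/3]$: (i) $j:=\max_{i\in[s]}\Big\{\frac{4\sigma}{\epsilon^2k_i}\Big(r\log\frac{\sigma}{(1-\epsilon)k_i}+\log\frac{8}{\epsilon^2}\Big),\ \frac{\sigma r}{\epsilon k_i}\Big\}$ and $n\ge(1-\epsilon)^{-1}\sigma$, where $\sigma:=\sum_{i=1}^s\alpha_ik_i$ and $\sigma\ge k_i$ for every $i$; (ii) $j:=\max_{i\in[s]}\Big\{\frac{4\alpha_is}{\epsilon^2}\Big(r\log\frac{\alpha_is}{1-\epsilon}+\log\frac{8}{\epsilon^2}\Big),\ r\alpha_is\epsilon^{-1}\Big\}$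 and $n\ge\max_{i\in[s]}(1-\epsilon)^{-1}\alpha_isk_i$; (iii) for some $C\ge 2$, $j:=\max_{i\in[s]}\alpha_isr\log_C(Ce\alpha_is)$ and $n\ge\max_{i\in[s]}Ce\alpha_isk_i$.
   Context: All logarithms without a base are natural. $[m]=\{1,\dots,m\}$; for a real $j$, $[j]$ denotes $\{1,\dots,\lfloor j\rfloor\}$. $\binom{[n]}{k}$ is the family of $k$-element subsets of $[n]$. A family $\mathcal J\subset\binom{[n]}{k}$ is a junta with center $[j]$ if there is a family $\mathcal J^*\subset 2^{[j]}$ with $\mathcal J=\{F\in\binom{[n]}{k}: F\cap[j]\in\mathcal J^*\}$. *)

theory Defs
  imports Complex_Main "HOL-Library.Ramsey"
begin

text \<open>\<open>[j]\<close> for real \<open>j\<close>; since \<^const>\<open>nat\<close> truncates, it is empty when \<open>j < 1\<close>,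
  including negative \<open>j\<close>. The family of \<open>k\<close>-subsets of \<open>[n]\<close> is \<open>nsets {1..n} k\<close>.\<close>

definition seg :: "real \<Rightarrow> nat set" where
  "seg j = {1..nat \<lfloor>j\<rfloor>}"

definition junta :: "nat \<Rightarrow> nat \<Rightarrow> real \<Rightarrow> nat set set \<Rightarrow> bool" where
  "junta n k j J \<longleftrightarrow>
     (\<exists>Jstar \<subseteq> Pow (seg j). J = {A \<in> nsets {1..n} k. A \<inter> seg j \<in> Jstar})"

text \<open>The inequality \<open>(*)\<close> for a tuple \<open>A 1, \<dots>, A s\<close> of sets at the point \<open>l\<close>.\<close>

definition meets :: "nat \<Rightarrow> (nat \<Rightarrow> real) \<Rightarrow> real \<Rightarrow> (nat \<Rightarrow> nat set) \<Rightarrow> nat \<Rightarrow> bool" where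
  "meets s \<alpha> q A l \<longleftrightarrow> (\<Sum>i=1..s. \<alpha> i * real (card (A i \<inter> {1..l}))) \<ge> real l + q"

end

theory Submission
  imports Defs
begin

text \<open>Split the threshold in \<open>(*)\<close> as \<open>l = \<Sum>i. \<alpha> i * \<beta> i * l\<close>, with \<open>\<beta> i = k i / \<sigma>\<close> in case (i) and
  \<open>\<beta> i = 1 / (\<alpha> i * s)\<close> in cases (ii) and (iii). Call a \<open>k i\<close>-set \<open>X\<close> bad if
  \<open>card (X \<inter> [l]) \<ge> \<beta> i * l\<close> for some \<open>l > j\<close>. If no \<open>X i\<close> is bad, then \<open>(*)\<close> can only hold at
  some \<open>l \<le> j\<close>, so the juntas generated by the traces on \<open>[j]\<close> of the good members of \<open>F i\<close> work,
  and it remains to count the bad sets. Grouping the \<open>l\<close> by the value \<open>t = card (X \<inter> [l])\<close>, a bad set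
  has at least \<open>t\<close> elements in \<open>[t / \<beta> i]\<close> for some \<open>t \<ge> \<beta> i * j\<close>. For each \<open>t\<close> this is a
  hypergeometric tail event, estimated by Chernoff's bound in (i) and (ii) and by the number of
  \<open>t\<close>-subsets of \<open>[t / \<beta> i]\<close> in (iii); the estimates decay geometrically in \<open>t\<close>.\<close>

section \<open>Hypergeometric tail estimates\<close>

text \<open>The quotient of the two binomials, which is the chance that a random
  \<open>k\<close>-set contains a fixed \<open>m\<close>-set, is the product of
  \<open>(k - i) / (n - i)\<close> over \<open>i < m\<close>, and each factor is at most
  \<open>k / n\<close>.\<close>

lemma binomial_diff_le:
  assumes "m \<le> k" "k \<le> n"
  shows "real ((n - m) choose (k - m)) \<le> (real k / real n) ^ m * real (n choose k)"
  using assms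
proof (induction m)
  case (Suc m)
  have eq: "(k - m) * ((n - m) choose (k - m)) = (n - m) * ((n - Suc m) choose (k - Suc m))"
    using times_binomial_minus1_eq[of "k - m" "n - m"] Suc.prems by simp
  have "real ((n - Suc m) choose (k - Suc m))
      = real (k - m) / real (n - m) * real ((n - m) choose (k - m))"
    using arg_cong[OF eq, of real] Suc.prems by (simp add: field_simps)
  also have "\<dots> \<le> real k / real n * real ((n - m) choose (k - m))"
  proof (rule mult_right_mono)
    have "real m * real k \<le> real m * real n"
      using Suc.prems by (intro mult_left_mono) auto
    then show "real (k - m) / real (n - m) \<le> real k / real n"
      using Suc.prems by (simp add: field_simps of_nat_diff)
  qed simp
  also have "\<dots> \<le> real k / real n * ((real k / real n) ^ m * real (n choose k))"
    using Suc by (intro mult_left_mono) auto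
  finally show ?case by simp
qed simp

lemma card_nsets_superset_le:
  assumes "finite A"
  shows "real (card {X \<in> nsets A k. M \<subseteq> X})
    \<le> (real k / real (card A)) ^ card M * real (card A choose k)"
proof (cases "\<exists>X \<in> nsets A k. M \<subseteq> X")
  case True
  then have M: "M \<subseteq> A" "finite M" "card M \<le> k" "k \<le> card A"
    using assms by (auto simp: nsets_def intro: card_mono finite_subset)
  have "card {X \<in> nsets A k. M \<subseteq> X} \<le> card (nsets (A - M) (k - card M))"
  proof (rule card_inj_on_le[where f = "\<lambda>X. X - M"])
    show "inj_on (\<lambda>X. X - M) {X \<in> nsets A k. M \<subseteq> X}"
      by (auto simp: inj_on_def)
    show "(\<lambda>X. X - M) ` {X \<in> nsets A k. M \<subseteq> X} \<subseteq> nsets (A - M) (k - card M)"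
      using M by (auto simp: nsets_def card_Diff_subset)
    show "finite (nsets (A - M) (k - card M))"
      using assms by (simp add: finite_imp_finite_nsets)
  qed
  also have "\<dots> = (card A - card M) choose (k - card M)"
    using M by (simp add: card_Diff_subset)
  finally show ?thesis
    using binomial_diff_le[OF M(3,4)] by linarith
next
  case False
  then have "{X \<in> nsets A k. M \<subseteq> X} = {}" by blast
  then show ?thesis by (simp only:) simp
qed

text \<open>Expanding each power over the subsets of \<open>X \<inter> L\<close> and swapping the
  sums reduces this to counting supersets. The hypergeometric moment generating function is thus
  dominated by the binomial one with success probability \<open>k / card A\<close>.\<close>

lemma sum_nsets_power_card_Int_le:
  fixes w :: real
  assumes "finite A" "finite L" "w \<ge> 0"
  shows "(\<Sum>X\<in>nsets A k. (1 + w) ^ card (X \<inter> L))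
    \<le> (1 + real k / real (card A) * w) ^ card L * real (card A choose k)"
proof -
  define p where "p = real k / real (card A)"
  have binom: "(1 + u) ^ card Y = (\<Sum>M\<in>Pow Y. u ^ card M)" if "finite Y" for u :: real and Y :: "'a set"
    using prod_add[OF that, of "\<lambda>_. u" "\<lambda>_. 1"] by (simp add: add.commute)
  have fin: "finite (nsets A k)"
    using assms by (simp add: finite_imp_finite_nsets)
  have "(\<Sum>X\<in>nsets A k. (1 + w) ^ card (X \<inter> L)) = (\<Sum>X\<in>nsets A k. \<Sum>M | M \<in> Pow L \<and> M \<subseteq> X. w ^ card M)"
  proof (rule sum.cong[OF refl])
    fix X
    have "{M. M \<in> Pow L \<and> M \<subseteq> X} = Pow (X \<inter> L)" by blast
    then show "(1 + w) ^ card (X \<inter> L) = (\<Sum>M | M \<in> Pow L \<and> M \<subseteq> X. w ^ card M)"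
      using assms by (simp add: binom)
  qed
  also have "\<dots> = (\<Sum>M\<in>Pow L. \<Sum>X | X \<in> nsets A k \<and> M \<subseteq> X. w ^ card M)"
    using fin assms by (intro sum.swap_restrict) auto
  also have "\<dots> = (\<Sum>M\<in>Pow L. w ^ card M * real (card {X \<in> nsets A k. M \<subseteq> X}))"
    by (simp add: mult.commute)
  also have "\<dots> \<le> (\<Sum>M\<in>Pow L. w ^ card M * (p ^ card M * real (card A choose k)))"
    unfolding p_def using assms by (intro sum_mono mult_left_mono card_nsets_superset_le) auto
  also have "\<dots> = (1 + p * w) ^ card L * real (card A choose k)"
    using assms by (simp add: binom sum_distrib_left power_mult_distrib mult_ac)
  finally show ?thesis by (simp add: p_def)
qed

text \<open>Markov's inequality for \<open>z ^ card (X \<inter> L)\<close>, with the previous lemma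
  and \<open>1 + x \<le> exp x\<close> bounding the mean.\<close>

lemma card_nsets_Int_ge_Chernoff:
  fixes \<beta> p :: real
  assumes "finite A" "finite L" and p: "p = real k / real (card A)" "0 < p" "p \<le> \<beta>"
    and L: "\<beta> * real (card L) \<le> real t"
  shows "real (card {X \<in> nsets A k. t \<le> card (X \<inter> L)})
    \<le> (p / \<beta> * exp (1 - p / \<beta>)) ^ t * real (card A choose k)"
proof -
  \<comment> \<open>This \<open>z\<close> minimizes the resulting bound
    \<open>exp (p * (z - 1) * card L) / z ^ t\<close> in the extreme case
    \<open>card L = t / \<beta>\<close>.\<close>
  define z N where "z = \<beta> / p" and "N = real (card A choose k)"
  have z: "z \<ge> 1" "\<beta> > 0" using p(2,3) by (auto simp: z_def)
  have fin: "finite (nsets A k)"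
    using assms by (simp add: finite_imp_finite_nsets)
  have "real (card {X \<in> nsets A k. t \<le> card (X \<inter> L)}) * z ^ t
      = (\<Sum>X | X \<in> nsets A k \<and> t \<le> card (X \<inter> L). z ^ t)"
    by simp
  also have "\<dots> \<le> (\<Sum>X | X \<in> nsets A k \<and> t \<le> card (X \<inter> L). z ^ card (X \<inter> L))"
    using z by (intro sum_mono power_increasing) auto
  also have "\<dots> \<le> (\<Sum>X\<in>nsets A k. z ^ card (X \<inter> L))"
    using fin z by (intro sum_mono2) auto
  also have "\<dots> \<le> (1 + p * (z - 1)) ^ card L * N"
    using sum_nsets_power_card_Int_le[of A L "z - 1" k] assms z by (simp add: N_def)
  also have "\<dots> \<le> exp (p * (z - 1)) ^ card L * N"
    using p z by (intro mult_right_mono power_mono exp_ge_add_one_self) (auto simp: N_def)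
  also have "\<dots> = exp ((1 - p / \<beta>) * (\<beta> * real (card L))) * N"
  proof -
    have "p * (z - 1) = (1 - p / \<beta>) * \<beta>"
      using p(2) z by (simp add: z_def field_simps)
    then show ?thesis by (simp add: mult_ac flip: exp_of_nat_mult)
  qed
  also have "\<dots> \<le> exp ((1 - p / \<beta>) * real t) * N"
    using p(3) z L by (intro mult_right_mono) (auto simp: N_def intro!: mult_left_mono)
  also have "\<dots> = exp (1 - p / \<beta>) ^ t * N"
    by (simp add: mult.commute flip: exp_of_nat_mult)
  finally have "real (card {X \<in> nsets A k. t \<le> card (X \<inter> L)})
      \<le> exp (1 - p / \<beta>) ^ t * N / z ^ t"
    using z by (simp add: pos_le_divide_eq)
  also have "\<dots> = (p / \<beta> * exp (1 - p / \<beta>)) ^ t * N"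
    using p(2) z by (simp add: z_def power_mult_distrib power_divide)
  finally show ?thesis by (simp add: N_def)
qed

text \<open>Passing from \<open>t\<close> to \<open>t + 1\<close> multiplies
  \<open>(t / e) ^ t\<close> by \<open>(t + 1) * (1 + 1 / t) ^ t / e\<close>, which is at most
  \<open>t + 1\<close>. The factor 2 comes from \<open>2 \<le> e\<close> at
  \<open>t = 1\<close>.\<close>

lemma two_power_div_exp_le_fact:
  assumes "t > 0"
  shows "2 * (real t / exp 1) ^ t \<le> fact t"
  using assms
proof (induction t rule: nat_induct_non_zero)
  case 1
  show ?case using exp_ge_add_one_self[of 1] by (simp add: field_simps)
next
  case (Suc t)
  have "(1 + 1 / real t) ^ t \<le> exp (1 / real t) ^ t"
    by (intro power_mono exp_ge_add_one_self) auto
  also have "\<dots> = exp 1"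
    using Suc.hyps by (simp flip: exp_of_nat_mult)
  finally have e: "(1 + 1 / real t) ^ t \<le> exp 1" .
  have "real (Suc t) = real t * (1 + 1 / real t)"
    using Suc.hyps by (simp add: field_simps)
  then have "2 * (real (Suc t) / exp 1) ^ Suc t
      = real (Suc t) * ((1 + 1 / real t) ^ t / exp 1) * (2 * (real t / exp 1) ^ t)"
    by (simp add: power_mult_distrib power_divide)
  also have "\<dots> \<le> real (Suc t) * 1 * fact t"
    using e Suc.IH by (intro mult_mono) auto
  finally show ?case by simp
qed

text \<open>Each counted \<open>X\<close> contains some \<open>t\<close>-subset of \<open>L\<close>.
  There are at most \<open>(t / \<beta>) ^ t / t!\<close> such subsets, and the lower bound on the
  factorial turns this into \<open>(e / \<beta>) ^ t / 2\<close>.\<close>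

lemma card_nsets_Int_ge_union_bound:
  fixes \<beta> p :: real
  assumes "finite A" "finite L" and p: "p = real k / real (card A)" and \<beta>: "0 < \<beta>"
    and L: "\<beta> * real (card L) \<le> real t" and "t > 0"
  shows "real (card {X \<in> nsets A k. t \<le> card (X \<inter> L)})
    \<le> (p / \<beta> * exp 1) ^ t / 2 * real (card A choose k)"
proof -
  define N where "N = real (card A choose k)"
  have finA: "finite (nsets A k)"
    using assms by (simp add: finite_imp_finite_nsets)
  have finL: "finite (nsets L t)"
    using assms by (simp add: finite_imp_finite_nsets)
  have sub: "{X \<in> nsets A k. t \<le> card (X \<inter> L)} \<subseteq> (\<Union>M\<in>nsets L t. {X \<in> nsets A k. M \<subseteq> X})"
  proof
    fix X assume X: "X \<in> {X \<in> nsets A k. t \<le> card (X \<inter> L)}"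
    then obtain M where "M \<subseteq> X \<inter> L" "card M = t" "finite M"
      using obtain_subset_with_card_n[of t "X \<inter> L"] by blast
    then show "X \<in> (\<Union>M\<in>nsets L t. {X \<in> nsets A k. M \<subseteq> X})"
      using X by (auto simp: nsets_def)
  qed
  have "card {X \<in> nsets A k. t \<le> card (X \<inter> L)}
      \<le> card (\<Union>M\<in>nsets L t. {X \<in> nsets A k. M \<subseteq> X})"
    using finA finL by (intro card_mono[OF _ sub]) auto
  also have "\<dots> \<le> (\<Sum>M\<in>nsets L t. card {X \<in> nsets A k. M \<subseteq> X})"
    using finL by (rule card_UN_le)
  finally have "real (card {X \<in> nsets A k. t \<le> card (X \<inter> L)})
      \<le> (\<Sum>M\<in>nsets L t. real (card {X \<in> nsets A k. M \<subseteq> X}))"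
    by (simp flip: of_nat_sum)
  also have "\<dots> \<le> (\<Sum>M\<in>nsets L t. p ^ t * N)"
  proof (rule sum_mono)
    fix M assume "M \<in> nsets L t"
    then show "real (card {X \<in> nsets A k. M \<subseteq> X}) \<le> p ^ t * N"
      using card_nsets_superset_le[OF assms(1), of k M] by (simp add: nsets_def N_def p)
  qed
  also have "\<dots> = real (card L choose t) * p ^ t * N"
    by simp
  also have "\<dots> \<le> (real t / \<beta>) ^ t / (2 * (real t / exp 1) ^ t) * p ^ t * N"
  proof (intro mult_right_mono)
    have "real ((card L choose t) * fact t) \<le> real (card L ^ t)"
      using binomial_fact_pow[of "card L" t] by (rule of_nat_mono)
    then have "real (card L choose t) \<le> real (card L) ^ t / fact t"
      by (simp add: pos_le_divide_eq)
    also have "real (card L) \<le> real t / \<beta>"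
      using L \<beta> by (simp add: pos_le_divide_eq mult.commute)
    then have "real (card L) ^ t / fact t \<le> (real t / \<beta>) ^ t / (2 * (real t / exp 1) ^ t)"
      using two_power_div_exp_le_fact[OF \<open>t > 0\<close>] \<beta> \<open>t > 0\<close>
      by (intro frac_le power_mono) auto
    finally show "real (card L choose t) \<le> (real t / \<beta>) ^ t / (2 * (real t / exp 1) ^ t)" .
  qed (auto simp: N_def p)
  also have "\<dots> = (p / \<beta> * exp 1) ^ t / 2 * N"
    using \<open>t > 0\<close> \<beta> by (simp add: power_divide power_mult_distrib field_simps)
  finally show ?thesis by (simp add: N_def)
qed

section \<open>Geometric tails and bad sets\<close>

text \<open>Factoring out the power at the least member of \<open>T\<close> leaves distinct
  exponents, hence part of the full geometric series. The threshold \<open>x\<close> will be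
  \<open>\<beta> * j\<close>, which need not be an integer; hence \<open>powr\<close>.\<close>

lemma sum_power_le_geometric_tail:
  fixes c x :: real
  assumes "finite T" "\<And>t. t \<in> T \<Longrightarrow> x \<le> real t" "0 < c" "c < 1"
  shows "(\<Sum>t\<in>T. c ^ t) \<le> c powr x / (1 - c)"
proof (cases "T = {}")
  case False
  define m where "m = Min T"
  have m: "m \<in> T" "\<And>t. t \<in> T \<Longrightarrow> m \<le> t"
    using assms False by (auto simp: m_def)
  have "(\<Sum>t\<in>T. c ^ t) = c ^ m * (\<Sum>t\<in>T. c ^ (t - m))"
    using m by (simp add: sum_distrib_left flip: power_add)
  also have "(\<Sum>t\<in>T. c ^ (t - m)) = (\<Sum>i\<in>(\<lambda>t. t - m) ` T. c ^ i)"
    using m by (subst sum.reindex) (auto simp: inj_on_def dest: eq_diff_iff)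
  also have "\<dots> \<le> (\<Sum>i. c ^ i)"
    using assms by (intro sum_le_suminf summable_geometric) auto
  also have "\<dots> = 1 / (1 - c)"
    using assms by (simp add: suminf_geometric)
  also have "c ^ m \<le> c powr x"
    using assms m powr_mono'[of x "real m" c] by (simp add: powr_realpow)
  finally show ?thesis
    using assms by (simp add: mult_left_mono mult_right_mono divide_right_mono)
qed (use assms in simp)

text \<open>The condition \<open>l > 0\<close> matters when \<open>j < 0\<close>, which case (iii)
  permits: at \<open>l = 0\<close> the inequality reads \<open>0 \<le> 0\<close>, and every
  \<open>k\<close>-set would be bad.\<close>

definition bad_sets :: "nat \<Rightarrow> nat \<Rightarrow> real \<Rightarrow> real \<Rightarrow> nat set set" where
  "bad_sets n k \<beta> j = {X \<in> nsets {1..n} k.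
     \<exists>l. l > 0 \<and> j < real l \<and> \<beta> * real l \<le> real (card (X \<inter> {1..l}))}"

lemma bad_sets_empty:
  assumes "\<beta> > 1"
  shows "bad_sets n k \<beta> j = {}"
proof -
  have "real (card (X \<inter> {1..l})) < \<beta> * real l" if "l > 0" for X and l :: nat
  proof -
    have "card (X \<inter> {1..l}) \<le> card {1..l}"
      by (intro card_mono) auto
    then have "real (card (X \<inter> {1..l})) \<le> 1 * real l" by simp
    also have "\<dots> < \<beta> * real l"
      using assms that by (intro mult_strict_right_mono) auto
    finally show ?thesis .
  qed
  then show ?thesis unfolding bad_sets_def not_le[symmetric] by blast
qed

text \<open>A witness \<open>l\<close> with \<open>t = card (X \<inter> {1..l})\<close> satisfies
  \<open>l \<le> t / \<beta>\<close>, so enlarging the interval removes \<open>l\<close> and leaves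
  at most \<open>k\<close> events. The bound \<open>b\<close> stays open to admit either tail
  estimate.\<close>

lemma card_bad_sets_le:
  fixes b :: "nat \<Rightarrow> real"
  assumes "\<beta> > 0"
    and b: "\<And>t. t > 0 \<Longrightarrow> \<beta> * j \<le> real t \<Longrightarrow>
      real (card {X \<in> nsets {1..n} k. t \<le> card (X \<inter> {1..nat \<lfloor>real t / \<beta>\<rfloor>})}) \<le> b t"
  shows "real (card (bad_sets n k \<beta> j)) \<le> (\<Sum>t | t \<in> {1..k} \<and> \<beta> * j \<le> real t. b t)"
proof -
  let ?T = "{t. t \<in> {1..k} \<and> \<beta> * j \<le> real t}"
  let ?E = "\<lambda>t. {X \<in> nsets {1..n} k. t \<le> card (X \<inter> {1..nat \<lfloor>real t / \<beta>\<rfloor>})}"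
  have fin: "finite (nsets {1..n} k)"
    by (simp add: finite_imp_finite_nsets)
  have sub: "bad_sets n k \<beta> j \<subseteq> (\<Union>t\<in>?T. ?E t)"
  proof
    fix X assume "X \<in> bad_sets n k \<beta> j"
    then obtain l where X: "X \<in> nsets {1..n} k" and l: "l > 0" "j < real l"
        "\<beta> * real l \<le> real (card (X \<inter> {1..l}))"
      by (auto simp: bad_sets_def)
    define t where "t = card (X \<inter> {1..l})"
    have "\<beta> * real l > 0" "\<beta> * j < \<beta> * real l"
      using l assms(1) by auto
    then have "t > 0" "\<beta> * j \<le> real t"
      using l by (auto simp: t_def simp del: card_gt_0_iff)
    moreover have "t \<le> k"
      using X card_mono[of X "X \<inter> {1..l}"] by (auto simp: nsets_def t_def)
    moreover have "l \<le> nat \<lfloor>real t / \<beta>\<rfloor>"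
      using l assms(1) by (simp add: t_def le_nat_floor field_simps)
    then have "t \<le> card (X \<inter> {1..nat \<lfloor>real t / \<beta>\<rfloor>})"
      unfolding t_def by (intro card_mono) auto
    ultimately show "X \<in> (\<Union>t\<in>?T. ?E t)"
      using X by (intro UN_I[of t]) auto
  qed
  have "card (bad_sets n k \<beta> j) \<le> card (\<Union>t\<in>?T. ?E t)"
    using fin by (intro card_mono[OF _ sub]) auto
  also have "\<dots> \<le> (\<Sum>t\<in>?T. card (?E t))"
    by (rule card_UN_le) simp
  finally have "real (card (bad_sets n k \<beta> j)) \<le> (\<Sum>t\<in>?T. real (card (?E t)))"
    by (simp flip: of_nat_sum)
  also have "\<dots> \<le> (\<Sum>t\<in>?T. b t)"
    using b by (intro sum_mono) auto
  finally show ?thesis .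
qed

lemma mult_nat_floor_divide_le:
  fixes \<beta> :: real
  assumes "\<beta> > 0"
  shows "\<beta> * real (nat \<lfloor>real t / \<beta>\<rfloor>) \<le> real t"
proof -
  have "real (nat \<lfloor>real t / \<beta>\<rfloor>) \<le> real t / \<beta>"
    using assms by (intro of_nat_floor) auto
  then show ?thesis using assms by (simp only: pos_le_divide_eq mult.commute)
qed

section \<open>Counting bad sets by Chernoff's bound, for cases (i) and (ii)\<close>

lemma ln_one_minus_le_quadratic:
  fixes x :: real
  assumes "0 \<le> x" "x < 1"
  shows "ln (1 - x) \<le> - x - x\<^sup>2 / 2"
proof -
  let ?h = "\<lambda>x::real. ln (1 - x) + x + x\<^sup>2 / 2"
  have "?h x \<le> ?h 0"
  proof (rule DERIV_nonpos_imp_nonincreasing[OF assms(1)])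
    fix y assume y: "0 \<le> y" "y \<le> x"
    then have "(?h has_real_derivative - (1 / (1 - y)) + 1 + y) (at y)"
      using assms by (auto intro!: derivative_eq_intros)
    moreover have "- (1 / (1 - y)) + 1 + y = - (y\<^sup>2 / (1 - y))"
      using y assms by (simp add: field_simps power2_eq_square)
    ultimately show "\<exists>d. (?h has_real_derivative d) (at y) \<and> d \<le> 0"
      using y assms by (intro exI[of _ "- (y\<^sup>2 / (1 - y))"]) auto
  qed
  then show ?thesis by simp
qed

text \<open>The two lower bounds on \<open>j\<close> have separate tasks. By \<open>j2\<close>,
  every relevant \<open>t\<close> is at least \<open>r / \<epsilon>\<close>, which yields a factor
  \<open>(p / ((1 - \<epsilon>) * \<beta>)) powr r\<close>. By \<open>j1\<close>, the remaining
  geometric tail is at most \<open>((1 - \<epsilon>) * \<beta>) powr r\<close>. Their product is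
  \<open>p powr r\<close>.\<close>

lemma card_bad_sets_le_Chernoff:
  fixes \<beta> \<epsilon> r j :: real
  assumes n: "n > 0" and k: "k > 0" and \<beta>: "\<beta> > 0" and r: "r > 0" and \<epsilon>: "0 < \<epsilon>" "\<epsilon> \<le> 1 / 3"
    and p: "real k / real n \<le> (1 - \<epsilon>) * \<beta>"
    and j1: "4 / (\<epsilon>\<^sup>2 * \<beta>) * (r * ln (1 / ((1 - \<epsilon>) * \<beta>)) + ln (8 / \<epsilon>\<^sup>2)) \<le> j"
    and j2: "r / (\<epsilon> * \<beta>) \<le> j"
  shows "real (card (bad_sets n k \<beta> j)) \<le> (real k / real n) powr r * real (n choose k)"
proof (cases "\<beta> > 1")
  case False
  \<comment> \<open>\<open>v\<close> measures on the logarithmic scale how far \<open>p\<close> lies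
    below its largest admissible value \<open>(1 - \<epsilon>) * \<beta>\<close>.\<close>
  define p y v N where "p = real k / real n" and "y = p / \<beta>" and "v = ln (y / (1 - \<epsilon>))"
    and "N = real (n choose k)"
  have p0: "p > 0" using n k by (simp add: p_def)
  have y: "0 < y" "y \<le> 1 - \<epsilon>"
    using p0 \<beta> p by (auto simp: y_def p_def[symmetric] pos_divide_le_eq)
  have e1: "1 - \<epsilon> > 0" using \<epsilon> by simp
  have v: "v \<le> 0" "ln y = v + ln (1 - \<epsilon>)"
    using y e1 by (auto simp: v_def ln_div)
  have yv: "(1 - \<epsilon>) - y \<le> - (1 - \<epsilon>) * v"
  proof -
    have "y / (1 - \<epsilon>) = exp v" using y e1 by (simp add: v_def)
    then have "y = (1 - \<epsilon>) * exp v" using e1 by (simp add: field_simps)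
    moreover have "(1 - \<epsilon>) * (1 + v) \<le> (1 - \<epsilon>) * exp v"
      using e1 by (intro mult_left_mono exp_ge_add_one_self) auto
    ultimately show ?thesis by (simp add: algebra_simps)
  qed
  \<comment> \<open>The term \<open>\<epsilon> * v\<close> gains the factor \<open>(y / (1 - \<epsilon>)) powr r\<close> when \<open>p\<close> is far below \<open>(1 - \<epsilon>) * \<beta>\<close>:
    the target \<open>p powr r\<close> then shrinks, while \<open>j\<close> does not depend on \<open>p\<close>.\<close>
  have log_le: "ln y + (1 - y) \<le> \<epsilon> * v - \<epsilon>\<^sup>2 / 4"
  proof -
    have "ln y + (1 - y) \<le> v + (ln (1 - \<epsilon>) + \<epsilon>) - (1 - \<epsilon>) * v"
      using yv v by (simp add: algebra_simps)
    also have "\<dots> \<le> v + (- (\<epsilon>\<^sup>2 / 2)) - (1 - \<epsilon>) * v"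
      using ln_one_minus_le_quadratic[of \<epsilon>] \<epsilon> by simp
    also have "\<dots> = \<epsilon> * v - \<epsilon>\<^sup>2 / 4 - \<epsilon>\<^sup>2 / 4" by (simp add: left_diff_distrib)
    also have "\<dots> \<le> \<epsilon> * v - \<epsilon>\<^sup>2 / 4" by simp
    finally show ?thesis .
  qed
  \<comment> \<open>The exponent is the reciprocal of the factor
    \<open>4 / \<epsilon>\<^sup>2\<close> in \<open>j1\<close>, so
    \<open>c powr (\<beta> * j)\<close> is at most
    \<open>((1 - \<epsilon>) * \<beta>) powr r * \<epsilon>\<^sup>2 / 8\<close>.\<close>
  define c where "c = exp (- (\<epsilon>\<^sup>2 / 4))"
  have c: "0 < c" "c < 1" using \<epsilon> by (auto simp: c_def)
  have \<beta>j: "\<beta> * j \<ge> r / \<epsilon>"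
    using j2 \<beta> \<epsilon> by (simp add: field_simps)
  have tail: "real (card {X \<in> nsets {1..n} k. t \<le> card (X \<inter> {1..nat \<lfloor>real t / \<beta>\<rfloor>})})
      \<le> exp (r * v) * N * c ^ t" if t: "\<beta> * j \<le> real t" for t
  proof -
    have "\<epsilon> * v * real t \<le> r * v"
    proof -
      have "r / \<epsilon> \<le> real t" using t \<beta>j by simp
      then have "r \<le> \<epsilon> * real t" using \<epsilon> by (simp add: pos_divide_le_eq mult.commute)
      then show ?thesis using mult_right_mono_neg[OF _ v(1), of r "\<epsilon> * real t"] by (simp add: mult_ac)
    qed
    then have "(ln y + (1 - y)) * real t \<le> r * v - \<epsilon>\<^sup>2 / 4 * real t"
      using mult_right_mono[OF log_le, of "real t"] by (simp add: algebra_simps)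
    moreover have "(y * exp (1 - y)) ^ t = exp ((ln y + (1 - y)) * real t)"
      using y(1) by (simp only: exp_of_nat2_mult exp_add exp_ln)
    moreover have "exp (r * v) * c ^ t = exp (r * v - \<epsilon>\<^sup>2 / 4 * real t)"
      unfolding c_def exp_of_nat2_mult[symmetric] mult_exp_exp by simp
    ultimately have "(y * exp (1 - y)) ^ t \<le> exp (r * v) * c ^ t" by simp
    then have "(y * exp (1 - y)) ^ t * N \<le> exp (r * v) * c ^ t * N"
      by (rule mult_right_mono) (simp add: N_def)
    moreover have "p \<le> \<beta>"
      using y \<epsilon> \<beta> by (auto simp: y_def pos_divide_le_eq intro: order_trans)
    then have "real (card {X \<in> nsets {1..n} k. t \<le> card (X \<inter> {1..nat \<lfloor>real t / \<beta>\<rfloor>})})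
      \<le> (y * exp (1 - y)) ^ t * N"
      using card_nsets_Int_ge_Chernoff[of "{1..n}" "{1..nat \<lfloor>real t / \<beta>\<rfloor>}" p k \<beta> t]
        mult_nat_floor_divide_le[OF \<beta>, of t] p0 by (simp add: p_def y_def N_def)
    ultimately show ?thesis by (simp add: mult_ac)
  qed
  define M where "M = exp (r * v) * N"
  have M0: "M \<ge> 0" by (simp add: M_def N_def)
  have "real (card (bad_sets n k \<beta> j)) \<le> (\<Sum>t | t \<in> {1..k} \<and> \<beta> * j \<le> real t. M * c ^ t)"
    by (rule card_bad_sets_le[OF \<beta>]) (use tail in \<open>simp add: M_def\<close>)
  also have "\<dots> = M * (\<Sum>t | t \<in> {1..k} \<and> \<beta> * j \<le> real t. c ^ t)"
    by (simp add: sum_distrib_left)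
  also have "\<dots> \<le> M * (c powr (\<beta> * j) / (1 - c))"
    using c M0 by (intro mult_left_mono sum_power_le_geometric_tail) auto
  also have "\<dots> \<le> M * exp (r * ln ((1 - \<epsilon>) * \<beta>))"
  proof (rule mult_left_mono)
    have "ln (1 / ((1 - \<epsilon>) * \<beta>)) = - ln ((1 - \<epsilon>) * \<beta>)"
      using e1 \<beta> by (simp add: ln_div)
    then have "- r * ln ((1 - \<epsilon>) * \<beta>) + ln (8 / \<epsilon>\<^sup>2) \<le> \<epsilon>\<^sup>2 / 4 * (\<beta> * j)"
      using mult_left_mono[OF j1, of "\<epsilon>\<^sup>2 / 4 * \<beta>"] \<beta> \<epsilon> by simp
    then have "c powr (\<beta> * j) \<le> exp (r * ln ((1 - \<epsilon>) * \<beta>) - ln (8 / \<epsilon>\<^sup>2))"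
      by (simp add: c_def powr_def algebra_simps)
    also have "\<dots> = exp (r * ln ((1 - \<epsilon>) * \<beta>)) * (\<epsilon>\<^sup>2 / 8)"
      using \<epsilon> by (simp add: exp_diff)
    finally have 1: "c powr (\<beta> * j) \<le> exp (r * ln ((1 - \<epsilon>) * \<beta>)) * (\<epsilon>\<^sup>2 / 8)" .
    \<comment> \<open>The term \<open>ln (8 / \<epsilon>\<^sup>2)\<close> in \<open>j1\<close> pays
      for the factor \<open>1 / (1 - c)\<close> of the geometric series.\<close>
    have 2: "\<epsilon>\<^sup>2 / 8 \<le> 1 - c"
    proof -
      define x where "x = \<epsilon>\<^sup>2 / 4"
      have "\<epsilon>\<^sup>2 \<le> 1\<^sup>2" using \<epsilon> by (intro power_mono) auto
      then have x: "0 \<le> x" "x \<le> 1" by (auto simp: x_def)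
      have "exp (- x) = inverse (exp x)" by (simp add: exp_minus)
      also have "\<dots> \<le> inverse (1 + x)"
        using x by (intro le_imp_inverse_le) (auto simp: exp_ge_add_one_self)
      also have "\<dots> \<le> 1 - x / 2"
      proof -
        have "x * x \<le> 1 * x" using x by (intro mult_right_mono) auto
        then have "1 \<le> (1 - x / 2) * (1 + x)" by (simp add: algebra_simps)
        then show ?thesis using x by (simp add: inverse_eq_divide pos_divide_le_eq)
      qed
      finally show ?thesis by (simp add: c_def x_def)
    qed
    have "c powr (\<beta> * j) / (1 - c) \<le> exp (r * ln ((1 - \<epsilon>) * \<beta>)) * (\<epsilon>\<^sup>2 / 8) / (1 - c)"
      using 1 c by (intro divide_right_mono) auto
    also have "\<dots> \<le> exp (r * ln ((1 - \<epsilon>) * \<beta>))"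
      using 2 c by (simp add: pos_divide_le_eq)
    finally show "c powr (\<beta> * j) / (1 - c) \<le> exp (r * ln ((1 - \<epsilon>) * \<beta>))" .
  qed (rule M0)
  also have "\<dots> = p powr r * N"
  proof -
    have "v + ln ((1 - \<epsilon>) * \<beta>) = ln p"
      using p0 \<beta> e1 by (simp add: v_def y_def ln_div ln_mult)
    then have "exp (r * v) * exp (r * ln ((1 - \<epsilon>) * \<beta>)) = p powr r"
      using p0 by (simp add: powr_def flip: exp_add distrib_left)
    then show ?thesis by (simp add: M_def mult_ac)
  qed
  finally show ?thesis by (simp add: p_def N_def)
qed (simp add: bad_sets_empty)

section \<open>Counting bad sets by their \<open>t\<close>-subsets, for case (iii)\<close>

text \<open>The tail bounds are \<open>c ^ t / 2\<close> with
  \<open>c = e * p / \<beta> \<le> 1 / C \<le> 1 / 2\<close>, so their sum is at most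
  \<open>c powr (\<beta> * j)\<close>. The choice of \<open>j\<close> makes this at most
  \<open>p powr r\<close>.\<close>

lemma card_bad_sets_le_union_bound:
  fixes \<beta> C r j :: real
  assumes n: "n > 0" and k: "k > 0" and \<beta>: "\<beta> > 0" and r: "r > 0" and C: "C \<ge> 2"
    and p: "C * exp 1 * (real k / real n) \<le> \<beta>"
    and j: "r / \<beta> * log C (C * exp 1 / \<beta>) \<le> j"
  shows "real (card (bad_sets n k \<beta> j)) \<le> (real k / real n) powr r * real (n choose k)"
proof (cases "\<beta> > 1")
  case False
  define p N c where "p = real k / real n" and "N = real (n choose k)" and "c = p / \<beta> * exp 1"
  have p0: "p > 0" using n k by (simp add: p_def)
  have c: "c > 0" "c \<le> 1 / C"
    using p p0 \<beta> C by (auto simp: c_def field_simps simp flip: p_def)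
  have "1 / C \<le> 1 / 2" using C by (simp add: field_simps)
  then have c2: "c \<le> 1 / 2" using c by simp
  define a where "a = ln (C * exp 1 / \<beta>)"
  have lnC: "ln C > 0" using C by simp
  have a: "a \<ge> ln C"
  proof -
    \<comment> \<open>Here \<open>\<beta> \<le> 1\<close> enters, through
      \<open>e / \<beta> \<ge> 1\<close>.\<close>
    have "C * 1 \<le> C * (exp 1 / \<beta>)"
      using C \<beta> False exp_ge_add_one_self[of 1] by (intro mult_left_mono) (auto simp: field_simps)
    then show ?thesis using C \<beta> by (simp add: a_def)
  qed
  have "real (card (bad_sets n k \<beta> j)) \<le> (\<Sum>t | t \<in> {1..k} \<and> \<beta> * j \<le> real t. N / 2 * c ^ t)"
  proof (rule card_bad_sets_le[OF \<beta>])
    fix t :: nat assume "t > 0"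
    then show "real (card {X \<in> nsets {1..n} k. t \<le> card (X \<inter> {1..nat \<lfloor>real t / \<beta>\<rfloor>})}) \<le> N / 2 * c ^ t"
      using card_nsets_Int_ge_union_bound[of "{1..n}" "{1..nat \<lfloor>real t / \<beta>\<rfloor>}" p k \<beta> t]
        mult_nat_floor_divide_le[OF \<beta>, of t] \<beta> by (simp add: p_def c_def N_def mult_ac)
  qed
  also have "\<dots> = N / 2 * (\<Sum>t | t \<in> {1..k} \<and> \<beta> * j \<le> real t. c ^ t)"
    by (simp add: sum_distrib_left)
  also have "\<dots> \<le> N / 2 * (c powr (\<beta> * j) / (1 - c))"
    using c c2 by (intro mult_left_mono sum_power_le_geometric_tail) (auto simp: N_def)
  \<comment> \<open>The bound \<open>t! \<ge> 2 (t / e)\<^sup>t\<close> saves exactly the factor \<open>2\<close> that the geometric series costs.\<close>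
  also have "\<dots> \<le> N / 2 * (c powr (\<beta> * j) / (1 / 2))"
    using c2 by (intro mult_left_mono divide_left_mono) (auto simp: N_def)
  also have "\<dots> = c powr (\<beta> * j) * N" by simp
  also have "\<dots> \<le> p powr r * N"
  proof (rule mult_right_mono)
    \<comment> \<open>\<open>u\<close> is the logarithm of \<open>p\<close> relative to its largest
      admissible value \<open>\<beta> / (C * e)\<close>. At \<open>u = 0\<close> the least
      admissible \<open>j\<close> gives equality; for \<open>u < 0\<close> the left side gains
      \<open>r * (a / ln C) * u\<close>, which suffices since
      \<open>a / ln C \<ge> 1\<close>.\<close>
    define u where "u = ln p + a"
    have lnc: "ln c = u - ln C"
      using p0 \<beta> C by (simp add: c_def u_def a_def ln_div ln_mult)
    have "ln c \<le> ln (1 / C)" using c C by (subst ln_le_cancel_iff) auto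
    then have "ln c \<le> - ln C" using C by (simp add: ln_div)
    then have u: "u \<le> 0" "ln c \<le> 0" using lnc lnC by linarith+
    have "r * (a / ln C) \<le> \<beta> * j"
      using mult_left_mono[OF j, of \<beta>] \<beta> by (simp add: log_def a_def)
    then have "\<beta> * j * ln c \<le> r * (a / ln C) * ln c"
      using u by (intro mult_right_mono_neg)
    also have "\<dots> = r * (a / ln C * u) - r * a"
      using lnC by (simp add: lnc field_simps)
    also have "\<dots> \<le> r * (1 * u) - r * a"
      using u a lnC r by (intro diff_right_mono mult_left_mono mult_right_mono_neg) auto
    also have "\<dots> = r * ln p" by (simp add: u_def algebra_simps)
    finally show "c powr (\<beta> * j) \<le> p powr r"
      using c p0 by (simp add: powr_def)
  qed (simp add: N_def)
  finally show ?thesis by (simp add: p_def N_def)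
qed (simp add: bad_sets_empty)

section \<open>From few bad sets to juntas\<close>

lemma junta_approximation:
  fixes \<alpha> \<beta> :: "nat \<Rightarrow> real" and q j :: real
  assumes s: "s > 0" and q: "q \<ge> 0" and \<alpha>: "\<forall>i\<in>{1..s}. \<alpha> i > 0"
    and F: "\<forall>i\<in>{1..s}. F i \<subseteq> nsets {1..n} (k i)"
    and cross: "\<forall>A. (\<forall>i\<in>{1..s}. A i \<in> F i) \<longrightarrow> (\<exists>l\<in>S. meets s \<alpha> q A l)"
    and S: "\<forall>l\<in>S. l > 0"
    and \<beta>: "(\<Sum>i=1..s. \<alpha> i * \<beta> i) \<le> 1"
    and bad: "\<And>i. i \<in> {1..s} \<Longrightarrow> real (card (bad_sets n (k i) (\<beta> i) j)) \<le> B i"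
  shows "\<exists>J :: nat \<Rightarrow> nat set set.
      (\<forall>i\<in>{1..s}. J i \<subseteq> nsets {1..n} (k i) \<and> junta n (k i) j (J i))
    \<and> (\<forall>A. (\<forall>i\<in>{1..s}. A i \<in> J i) \<longrightarrow> (\<exists>l \<in> S \<inter> seg j. meets s \<alpha> q A l))
    \<and> (\<forall>i\<in>{1..s}. real (card (F i - J i)) \<le> B i)"
proof -
  define G where "G i = F i - bad_sets n (k i) (\<beta> i) j" for i
  define J where "J i = {X \<in> nsets {1..n} (k i). X \<inter> seg j \<in> (\<lambda>X. X \<inter> seg j) ` G i}" for i
  have "\<exists>l \<in> S \<inter> seg j. meets s \<alpha> q A l" if A: "\<forall>i\<in>{1..s}. A i \<in> J i" for A
  proof -
    from A have "\<forall>i\<in>{1..s}. \<exists>X. X \<in> G i \<and> A i \<inter> seg j = X \<inter> seg j"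
      by (fastforce simp: J_def)
    then obtain X where X: "\<forall>i\<in>{1..s}. X i \<in> G i \<and> A i \<inter> seg j = X i \<inter> seg j"
      by metis
    then obtain l where l: "l \<in> S" "meets s \<alpha> q X l"
      using cross by (auto simp: G_def)
    then have l0: "l > 0" using S by auto
    have lj: "real l \<le> j"
    proof (rule ccontr)
      assume "\<not> real l \<le> j"
      then have "real (card (X i \<inter> {1..l})) < \<beta> i * real l" if "i \<in> {1..s}" for i
      proof -
        have "X i \<in> nsets {1..n} (k i)" "X i \<notin> bad_sets n (k i) (\<beta> i) j"
          using X F that unfolding G_def by blast+
        then show ?thesis
          using l0 \<open>\<not> real l \<le> j\<close> by (auto simp: bad_sets_def not_le)
      qed
      then have "(\<Sum>i=1..s. \<alpha> i * real (card (X i \<inter> {1..l}))) < (\<Sum>i=1..s. \<alpha> i * (\<beta> i * real l))"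
        using s \<alpha> by (intro sum_strict_mono) auto
      also have "\<dots> = (\<Sum>i=1..s. \<alpha> i * \<beta> i) * real l"
        by (simp add: sum_distrib_right mult.assoc)
      also have "\<dots> \<le> 1 * real l"
        using \<beta> by (intro mult_right_mono) auto
      finally show False using l(2) q by (simp add: meets_def)
    qed
    then have lseg: "l \<in> seg j" "{1..l} \<subseteq> seg j"
      using l0 by (auto simp: seg_def le_nat_floor)
    have "A i \<inter> {1..l} = X i \<inter> {1..l}" if "i \<in> {1..s}" for i
      using X that lseg(2) by blast
    then have "meets s \<alpha> q A l" using l(2) by (simp add: meets_def)
    then show ?thesis using l lseg by auto
  qed
  moreover have "junta n (k i) j (J i)" for i
    unfolding junta_def J_def by (intro exI[of _ "(\<lambda>X. X \<inter> seg j) ` G i"]) auto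
  moreover have "real (card (F i - J i)) \<le> B i" if i: "i \<in> {1..s}" for i
  proof -
    have "F i - J i \<subseteq> bad_sets n (k i) (\<beta> i) j"
      using F i by (auto simp: J_def G_def)
    moreover have "finite (bad_sets n (k i) (\<beta> i) j)"
      by (rule finite_subset[of _ "nsets {1..n} (k i)"])
        (auto simp: bad_sets_def finite_imp_finite_nsets)
    ultimately have "card (F i - J i) \<le> card (bad_sets n (k i) (\<beta> i) j)"
      by (rule card_mono[rotated])
    then show ?thesis using bad[OF i] by linarith
  qed
  ultimately show ?thesis
    by (intro exI[of _ J]) (auto simp: J_def)
qed

theorem theorem3p1:
  fixes n s :: nat and k :: "nat \<Rightarrow> nat" and q r \<epsilon> \<sigma> j :: real
    and \<alpha> :: "nat \<Rightarrow> real" and S :: "nat set" and F :: "nat \<Rightarrow> nat set set"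
  assumes "n \<ge> 2" and "s \<ge> 2"
    and "\<forall>i\<in>{1..s}. k i > 0"
    and "q \<ge> 0"
    and "\<forall>i\<in>{1..s}. \<alpha> i > 0"
    and "\<forall>l\<in>S. l > 0"
    and "\<forall>i\<in>{1..s}. F i \<subseteq> nsets {1..n} (k i)"
    and "\<forall>A. (\<forall>i\<in>{1..s}. A i \<in> F i) \<longrightarrow> (\<exists>l\<in>S. meets s \<alpha> q A l)"
    and "r > 0"
    and "0 < \<epsilon>" and "\<epsilon> \<le> 1 / 3"
    and "\<sigma> = (\<Sum>i=1..s. \<alpha> i * real (k i))"
    and "(j = Max ((\<lambda>i. max
              (4 * \<sigma> / (\<epsilon>\<^sup>2 * real (k i)) *
                 (r * ln (\<sigma> / ((1 - \<epsilon>) * real (k i))) + ln (8 / \<epsilon>\<^sup>2)))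
              (\<sigma> * r / (\<epsilon> * real (k i)))) ` {1..s})
          \<and> real n \<ge> inverse (1 - \<epsilon>) * \<sigma>
          \<and> (\<forall>i\<in>{1..s}. \<sigma> \<ge> real (k i)))
       \<or> (j = Max ((\<lambda>i. max
              (4 * \<alpha> i * real s / \<epsilon>\<^sup>2 *
                 (r * ln (\<alpha> i * real s / (1 - \<epsilon>)) + ln (8 / \<epsilon>\<^sup>2)))
              (r * \<alpha> i * real s * inverse \<epsilon>)) ` {1..s})
          \<and> real n \<ge> Max ((\<lambda>i. inverse (1 - \<epsilon>) * \<alpha> i * real s * real (k i)) ` {1..s}))
       \<or> (\<exists>C::real. C \<ge> 2
          \<and> j = Max ((\<lambda>i. \<alpha> i * real s * r * log C (C * exp 1 * \<alpha> i * real s)) ` {1..s})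
          \<and> real n \<ge> Max ((\<lambda>i. C * exp 1 * \<alpha> i * real s * real (k i)) ` {1..s}))"
  shows "\<exists>J :: nat \<Rightarrow> nat set set.
      (\<forall>i\<in>{1..s}. J i \<subseteq> nsets {1..n} (k i) \<and> junta n (k i) j (J i))
    \<and> (\<forall>A. (\<forall>i\<in>{1..s}. A i \<in> J i) \<longrightarrow> (\<exists>l \<in> S \<inter> seg j. meets s \<alpha> q A l))
    \<and> (\<forall>i\<in>{1..s}. real (card (F i - J i))
          \<le> (real (k i) / real n) powr r * real (n choose k i))"
proof -
  have s0: "s > 0" and n0: "n > 0" using assms(1,2) by auto
  have k0: "k i > 0" and \<alpha>0: "\<alpha> i > 0" if "i \<in> {1..s}" for i
    using assms(3,5) that by auto
  note junta = junta_approximation[OF s0 assms(4,5,7,8,6)]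
  have sum1: "(\<Sum>i=1..s. \<alpha> i * (1 / (\<alpha> i * real s))) \<le> 1"
  proof -
    have "(\<Sum>i=1..s. \<alpha> i * (1 / (\<alpha> i * real s))) = (\<Sum>i=1..s. 1 / real s)"
      using \<alpha>0 by (intro sum.cong) (auto simp: less_imp_neq[symmetric])
    then show ?thesis using s0 by simp
  qed
  from assms(13) show ?thesis
  proof (elim disjE conjE exE)
    assume j: "j = Max ((\<lambda>i. max
              (4 * \<sigma> / (\<epsilon>\<^sup>2 * real (k i)) *
                 (r * ln (\<sigma> / ((1 - \<epsilon>) * real (k i))) + ln (8 / \<epsilon>\<^sup>2)))
              (\<sigma> * r / (\<epsilon> * real (k i)))) ` {1..s})"
      and n: "real n \<ge> inverse (1 - \<epsilon>) * \<sigma>"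
    have \<sigma>: "\<sigma> > 0"
      unfolding assms(12) using s0 k0 \<alpha>0 by (intro sum_pos) auto
    show ?thesis
    \<comment> \<open>With these weights \<open>1 / ((1 - \<epsilon>) * \<beta> i)\<close> is
      \<open>\<sigma> / ((1 - \<epsilon>) * k i)\<close>, so the two entries of the maximum are
      exactly the lower bounds on \<open>j\<close> in the Chernoff count.\<close>
    proof (rule junta[where \<beta> = "\<lambda>i. real (k i) / \<sigma>"])
      show "(\<Sum>i=1..s. \<alpha> i * (real (k i) / \<sigma>)) \<le> 1"
        using \<sigma> by (simp add: assms(12) flip: sum_divide_distrib)
    next
      fix i assume i: "i \<in> {1..s}"
      have ji: "max (4 * \<sigma> / (\<epsilon>\<^sup>2 * real (k i)) *
                 (r * ln (\<sigma> / ((1 - \<epsilon>) * real (k i))) + ln (8 / \<epsilon>\<^sup>2)))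
              (\<sigma> * r / (\<epsilon> * real (k i))) \<le> j"
        unfolding j using i by (intro Max_ge) auto
      show "real (card (bad_sets n (k i) (real (k i) / \<sigma>) j))
          \<le> (real (k i) / real n) powr r * real (n choose k i)"
      proof (rule card_bad_sets_le_Chernoff[OF n0 k0[OF i] _ assms(9,10,11)])
        have "real (k i) * \<sigma> \<le> real (k i) * ((1 - \<epsilon>) * real n)"
          using n assms(11) by (intro mult_left_mono) (auto simp: field_simps)
        then show "real (k i) / real n \<le> (1 - \<epsilon>) * (real (k i) / \<sigma>)"
          using \<sigma> n0 by (simp add: field_simps)
      qed (use ji \<sigma> k0[OF i] in \<open>simp_all add: mult_ac\<close>)
    qed
  next
    assume j: "j = Max ((\<lambda>i. max
              (4 * \<alpha> i * real s / \<epsilon>\<^sup>2 *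
                 (r * ln (\<alpha> i * real s / (1 - \<epsilon>)) + ln (8 / \<epsilon>\<^sup>2)))
              (r * \<alpha> i * real s * inverse \<epsilon>)) ` {1..s})"
      and n: "real n \<ge> Max ((\<lambda>i. inverse (1 - \<epsilon>) * \<alpha> i * real s * real (k i)) ` {1..s})"
    show ?thesis
    \<comment> \<open>Here the threshold \<open>l\<close> is shared equally: each of the
      \<open>s\<close> sets accounts for \<open>l / s\<close>.\<close>
    proof (rule junta[OF sum1])
      fix i assume i: "i \<in> {1..s}"
      have ji: "max (4 * \<alpha> i * real s / \<epsilon>\<^sup>2 *
                 (r * ln (\<alpha> i * real s / (1 - \<epsilon>)) + ln (8 / \<epsilon>\<^sup>2)))
              (r * \<alpha> i * real s * inverse \<epsilon>) \<le> j"
        unfolding j using i by (intro Max_ge) auto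
      have ni: "inverse (1 - \<epsilon>) * \<alpha> i * real s * real (k i) \<le> real n"
        by (rule order_trans[OF Max_ge n]) (use i in auto)
      show "real (card (bad_sets n (k i) (1 / (\<alpha> i * real s)) j))
          \<le> (real (k i) / real n) powr r * real (n choose k i)"
      proof (rule card_bad_sets_le_Chernoff[OF n0 k0[OF i] _ assms(9,10,11)])
        show "real (k i) / real n \<le> (1 - \<epsilon>) * (1 / (\<alpha> i * real s))"
          using ni n0 s0 \<alpha>0[OF i] assms(11) by (simp add: field_simps)
      qed (use ji s0 \<alpha>0[OF i] in \<open>simp_all add: field_simps\<close>)
    qed
  next
    fix C :: real
    assume C: "C \<ge> 2"
      and j: "j = Max ((\<lambda>i. \<alpha> i * real s * r * log C (C * exp 1 * \<alpha> i * real s)) ` {1..s})"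
      and n: "real n \<ge> Max ((\<lambda>i. C * exp 1 * \<alpha> i * real s * real (k i)) ` {1..s})"
    show ?thesis
    proof (rule junta[OF sum1])
      fix i assume i: "i \<in> {1..s}"
      have ji: "\<alpha> i * real s * r * log C (C * exp 1 * \<alpha> i * real s) \<le> j"
        unfolding j using i by (intro Max_ge) auto
      have ni: "C * exp 1 * \<alpha> i * real s * real (k i) \<le> real n"
        by (rule order_trans[OF Max_ge n]) (use i in auto)
      show "real (card (bad_sets n (k i) (1 / (\<alpha> i * real s)) j))
          \<le> (real (k i) / real n) powr r * real (n choose k i)"
      proof (rule card_bad_sets_le_union_bound[OF n0 k0[OF i] _ assms(9) C])
        show "C * exp 1 * (real (k i) / real n) \<le> 1 / (\<alpha> i * real s)"
          using ni n0 s0 \<alpha>0[OF i] by (simp add: field_simps)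
      qed (use ji s0 \<alpha>0[OF i] in \<open>simp_all add: mult_ac\<close>)
    qed
  qed
qed

end
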